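(* Let $\{\varphi_{n,i}\}_{i=0}^n$ (with $\varphi_{n,0}\equiv1$) be an EC system on $[\alpha,\beta]$ and $\{b_{n,i}\}_{i=0}^n$ the normalized B-basis of its span. The ordinary integral parametric curve $$\mathbf{c}(u)=\sum_{i=0}^{n}\boldsymbol{\lambda}_i\,\varphi_{n,i}(u),\quad u\in[\alpha,\beta],\quad \boldsymbol{\lambda}_i=[\lambda_i^{\ell}]_{\ell=1}^{\delta}\in\mathbb{R}^{\delta},\ \delta\ge 2,$$ of order $n$ can be written as an EC B-curve of the same order, $$\mathbf{c}(u)\equiv\sum_{j=0}^{n}\mathbf{p}_j\,b_{n,j}(u),\quad\forall u\in[\alpha,\beta],\quad \mathbf{p}_j=[p_j^{\ell}]_{\ell=1}^{\delta}\in\mathbb{R}^{\delta},$$ where $p_j^{\ell}=\sum_{i=0}^{n}\lambda_i^{\ell}\,t_{i,j}^{n}$ for $j=0,1,\ldots,n$ and $\ell=1,2,\ldots,\delta$, and $t_{i,j}^n$ are the numbers given explicitly in the context.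
   Context: Here $n\ge1$ and $-\infty<\alpha<\beta<\infty$. A system $\{\varphi_{n,i}\}_{i=0}^n\subset C^n([\alpha,\beta])$ is an extended Chebyshev (EC) system if for every $0\le r\le n$, all knots $\alpha\le u_0<\cdots<u_r\le\beta$, all positive integers $m_0,\dots,m_r$ with $\sum_k m_k=n+1$, and all reals $\xi_{k,\ell}$, there is a unique $f\in\mathbb{S}_n^{\alpha,\beta}:=\operatorname{span}\{\varphi_{n,i}\}_{i=0}^n$ with $f^{(\ell)}(u_k)=\xi_{k,\ell}$ for $\ell=0,\ldots,m_k-1$, $k=0,\ldots,r$. It is assumed throughout that the determinants of the coefficient matrices of these Hermite interpolation problems are strictly positive, and that $\varphi_{n,0}\equiv1$. The space $\mathbb{S}_n^{\alpha,\beta}$ has a unique non-negative normalized B-basis $\{b_{n,i}\}_{i=0}^n$ (standing fact of the paper, taken from the literature). It is a basis of $\mathbb{S}_n^{\alpha,\beta}$ consisting of non-negative functions that satisfies: $\sum_{i=0}^n b_{n,i}\equiv1$ on $[\alpha,\beta]$; $b_{n,0}(\alpha)=b_{n,n}(\beta)=1$; for every $i$, $b_{n,i}^{(j)}(\alpha)=0$ for $j=0,\ldots,i-1$ and $b_{n,i}^{(i)}(\alpha)>0$; and $b_{n,i}^{(j)}(\beta)=0$ for $j=0,\ldots,n-1-i$ and $(-1)^{n-i}b_{n,i}^{(n-i)}(\beta)>0$. The numbers $t_{i,j}^n$ are the entries of the matrix mapping the normalized B-basis to the ordinary basis ($\varphi_{n,i}=\sum_j t_{i,j}^n b_{n,j}$),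 given explicitly by: $t_{0,j}^{n}=1$ ($j=0,\ldots,n$), $t_{i,0}^{n}=\varphi_{n,i}(\alpha)$, $t_{i,n}^{n}=\varphi_{n,i}(\beta)$ ($i=0,\ldots,n$), and for $i=1,\ldots,n$, $j=1,\ldots,\lfloor n/2\rfloor$, $$t_{i,j}^{n}=\varphi_{n,i}(\alpha)-\frac{1}{b_{n,j}^{(j)}(\alpha)}\sum_{r=1}^{j-1}\frac{\varphi_{n,i}^{(r)}(\alpha)}{b_{n,r}^{(r)}(\alpha)}\left(b_{n,r}^{(j)}(\alpha)+\sum_{\ell=1}^{j-r-1}(-1)^{\ell}\sum_{r<k_1<\cdots<k_\ell<j}\frac{b_{n,r}^{(k_1)}(\alpha)b_{n,k_1}^{(k_2)}(\alpha)\cdots b_{n,k_{\ell-1}}^{(k_\ell)}(\alpha)b_{n,k_\ell}^{(j)}(\alpha)}{b_{n,k_1}^{(k_1)}(\alpha)\cdots b_{n,k_\ell}^{(k_\ell)}(\alpha)}\right)+\frac{\varphi_{n,i}^{(j)}(\alpha)}{b_{n,j}^{(j)}(\alpha)},$$ $$t_{i,n-j}^{n}=\varphi_{n,i}(\beta)-\frac{1}{b_{n,n-j}^{(j)}(\beta)}\sum_{r=1}^{j-1}\frac{\varphi_{n,i}^{(r)}(\beta)}{b_{n,n-r}^{(r)}(\beta)}\left(b_{n,n-r}^{(j)}(\beta)+\sum_{\ell=1}^{j-r-1}(-1)^{\ell}\sum_{r<k_1<\cdots<k_\ell<j}\frac{b_{n,n-r}^{(k_1)}(\beta)b_{n,n-k_1}^{(k_2)}(\beta)\cdots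 b_{n,n-k_{\ell-1}}^{(k_\ell)}(\beta)b_{n,n-k_\ell}^{(j)}(\beta)}{b_{n,n-k_1}^{(k_1)}(\beta)\cdots b_{n,n-k_\ell}^{(k_\ell)}(\beta)}\right)+\frac{\varphi_{n,i}^{(j)}(\beta)}{b_{n,n-j}^{(j)}(\beta)}.$$ Empty sums equal $0$; for even $n$ both formulas give the same value for the middle column. *)

theory Defs
  imports "Jordan_Normal_Form.Determinant" "HOL-Analysis.Analysis"
begin

text \<open>All derivatives are taken within the compact interval, so they are one-sided at its
  end points.\<close>

primrec deriv_within :: "real \<Rightarrow> real \<Rightarrow> nat \<Rightarrow> (real \<Rightarrow> real) \<Rightarrow> real \<Rightarrow> real" where
  "deriv_within \<alpha> \<beta> 0 f = f"
| "deriv_within \<alpha> \<beta> (Suc k) f =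
     (\<lambda>x. vector_derivative (deriv_within \<alpha> \<beta> k f) (at x within {\<alpha>..\<beta>}))"

definition Cn_on :: "nat \<Rightarrow> real \<Rightarrow> real \<Rightarrow> (real \<Rightarrow> real) \<Rightarrow> bool" where
  "Cn_on n \<alpha> \<beta> f \<longleftrightarrow>
     (\<forall>k<n. deriv_within \<alpha> \<beta> k f differentiable_on {\<alpha>..\<beta>}) \<and>
     continuous_on {\<alpha>..\<beta>} (deriv_within \<alpha> \<beta> n f)"

text \<open>Functions on the interval are represented by functions that are \<open>undefined\<close> outside it,
  so that equality in the span is equality on the interval.\<close>

definition fun_span :: "nat \<Rightarrow> real \<Rightarrow> real \<Rightarrow> (nat \<Rightarrow> real \<Rightarrow> real) \<Rightarrow> (real \<Rightarrow> real) set" where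
  "fun_span n \<alpha> \<beta> \<phi> = {f. \<exists>c. f = restrict (\<lambda>x. \<Sum>i\<le>n. c i * \<phi> i x) {\<alpha>..\<beta>}}"

definition hermite_knots :: "nat \<Rightarrow> real \<Rightarrow> real \<Rightarrow> nat \<Rightarrow> (nat \<Rightarrow> real) \<Rightarrow> (nat \<Rightarrow> nat) \<Rightarrow> bool" where
  "hermite_knots n \<alpha> \<beta> r u m \<longleftrightarrow>
     r \<le> n \<and> (\<forall>k\<le>r. u k \<in> {\<alpha>..\<beta>}) \<and> strict_mono_on {..r} u \<and>
     (\<forall>k\<le>r. 0 < m k) \<and> (\<Sum>k\<le>r. m k) = n + 1"

definition EC_system :: "nat \<Rightarrow> real \<Rightarrow> real \<Rightarrow> (nat \<Rightarrow> real \<Rightarrow> real) \<Rightarrow> bool" where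
  "EC_system n \<alpha> \<beta> \<phi> \<longleftrightarrow>
     (\<forall>i\<le>n. Cn_on n \<alpha> \<beta> (\<phi> i)) \<and>
     (\<forall>r u m. hermite_knots n \<alpha> \<beta> r u m \<longrightarrow>
        (\<forall>\<xi>. \<exists>!f. f \<in> fun_span n \<alpha> \<beta> \<phi> \<and>
           (\<forall>k\<le>r. \<forall>l<m k. deriv_within \<alpha> \<beta> l f (u k) = \<xi> k l)))"

text \<open>The rows of the coefficient matrix belong to the interpolation conditions
  \<open>(u\<^sub>k, l)\<close> in lexicographic order of \<open>(k, l)\<close>, its columns to the functions \<open>\<phi> i\<close>.\<close>

definition hermite_conditions :: "nat \<Rightarrow> (nat \<Rightarrow> real) \<Rightarrow> (nat \<Rightarrow> nat) \<Rightarrow> (real \<times> nat) list" where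
  "hermite_conditions r u m = concat (map (\<lambda>k. map (\<lambda>l. (u k, l)) [0..<m k]) [0..<Suc r])"

definition hermite_matrix ::
  "nat \<Rightarrow> real \<Rightarrow> real \<Rightarrow> (nat \<Rightarrow> real \<Rightarrow> real) \<Rightarrow> nat \<Rightarrow> (nat \<Rightarrow> real) \<Rightarrow> (nat \<Rightarrow> nat) \<Rightarrow> real Matrix.mat" where
  "hermite_matrix n \<alpha> \<beta> \<phi> r u m =
     Matrix.mat (n + 1) (n + 1)
       (\<lambda>(q, i). case hermite_conditions r u m ! q of (x, l) \<Rightarrow> deriv_within \<alpha> \<beta> l (\<phi> i) x)"

definition positive_hermite_dets :: "nat \<Rightarrow> real \<Rightarrow> real \<Rightarrow> (nat \<Rightarrow> real \<Rightarrow> real) \<Rightarrow> bool" where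
  "positive_hermite_dets n \<alpha> \<beta> \<phi> \<longleftrightarrow>
     (\<forall>r u m. hermite_knots n \<alpha> \<beta> r u m \<longrightarrow>
        0 < Determinant.det (hermite_matrix n \<alpha> \<beta> \<phi> r u m))"

definition fun_basis ::
  "nat \<Rightarrow> real \<Rightarrow> real \<Rightarrow> (nat \<Rightarrow> real \<Rightarrow> real) \<Rightarrow> (real \<Rightarrow> real) set \<Rightarrow> bool" where
  "fun_basis n \<alpha> \<beta> b S \<longleftrightarrow>
     fun_span n \<alpha> \<beta> b = S \<and>
     (\<forall>c. (\<forall>x\<in>{\<alpha>..\<beta>}. (\<Sum>i\<le>n. c i * b i x) = 0) \<longrightarrow> (\<forall>i\<le>n. c i = 0))"

definition normalized_B_basis ::
  "nat \<Rightarrow> real \<Rightarrow> real \<Rightarrow> (nat \<Rightarrow> real \<Rightarrow> real) \<Rightarrow> (nat \<Rightarrow> real \<Rightarrow> real) \<Rightarrow> bool" where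
  "normalized_B_basis n \<alpha> \<beta> \<phi> b \<longleftrightarrow>
     fun_basis n \<alpha> \<beta> b (fun_span n \<alpha> \<beta> \<phi>) \<and>
     (\<forall>i\<le>n. \<forall>x\<in>{\<alpha>..\<beta>}. 0 \<le> b i x) \<and>
     (\<forall>x\<in>{\<alpha>..\<beta>}. (\<Sum>i\<le>n. b i x) = 1) \<and>
     b 0 \<alpha> = 1 \<and> b n \<beta> = 1 \<and>
     (\<forall>i\<le>n. (\<forall>j<i. deriv_within \<alpha> \<beta> j (b i) \<alpha> = 0) \<and>
             0 < deriv_within \<alpha> \<beta> i (b i) \<alpha>) \<and>
     (\<forall>i\<le>n. (\<forall>j<n - i. deriv_within \<alpha> \<beta> j (b i) \<beta> = 0) \<and>
             0 < (- 1) ^ (n - i) * deriv_within \<alpha> \<beta> (n - i) (b i) \<beta>)"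

text \<open>The formulas for \<open>t\<^sub>i\<^sub>,\<^sub>j\<close> and \<open>t\<^sub>i\<^sub>,\<^sub>n\<^sub>-\<^sub>j\<close> have the same shape: write \<open>d k s\<close> for the \<open>s\<close>-th
  derivative of \<open>b k\<close> at \<open>\<alpha>\<close> (respectively of \<open>b (n - k)\<close> at \<open>\<beta>\<close>) and \<open>g s\<close> for the \<open>s\<close>-th
  derivative of \<open>\<phi> i\<close> at the same end point. The list \<open>ks\<close> runs over
  \<open>r < k\<^sub>1 < \<dots> < k\<^sub>l < j\<close>, and the numerator is the product of \<open>d\<close> over consecutive
  elements of \<open>r, k\<^sub>1, \<dots>, k\<^sub>l, j\<close>.\<close>

definition chains :: "nat \<Rightarrow> nat \<Rightarrow> nat \<Rightarrow> nat list set" where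
  "chains r j l = {ks. length ks = l \<and> sorted_wrt (<) (r # ks @ [j])}"

definition chain_sum :: "(nat \<Rightarrow> nat \<Rightarrow> real) \<Rightarrow> nat \<Rightarrow> nat \<Rightarrow> nat \<Rightarrow> real" where
  "chain_sum d r j l =
     (\<Sum>ks\<in>chains r j l.
        (let w = r # ks @ [j] in \<Prod>p\<le>l. d (w ! p) (w ! Suc p)) / (\<Prod>k\<leftarrow>ks. d k k))"

definition t_formula :: "(nat \<Rightarrow> nat \<Rightarrow> real) \<Rightarrow> (nat \<Rightarrow> real) \<Rightarrow> nat \<Rightarrow> real" where
  "t_formula d g j =
     g 0
     - 1 / d j j * (\<Sum>r = 1..j - 1. g r / d r r *
         (d r j + (\<Sum>l = 1..j - r - 1. (- 1) ^ l * chain_sum d r j l)))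
     + g j / d j j"

text \<open>For even \<open>n\<close> and \<open>j = n div 2\<close> the formulas at \<open>\<alpha>\<close> and at \<open>\<beta>\<close> both apply to column \<open>j\<close>
  and agree there; the one at \<open>\<alpha>\<close> is used.\<close>

definition t_coeff ::
  "nat \<Rightarrow> real \<Rightarrow> real \<Rightarrow> (nat \<Rightarrow> real \<Rightarrow> real) \<Rightarrow> (nat \<Rightarrow> real \<Rightarrow> real) \<Rightarrow> nat \<Rightarrow> nat \<Rightarrow> real" where
  "t_coeff n \<alpha> \<beta> \<phi> b i j =
     (if i = 0 then 1
      else if j = 0 then \<phi> i \<alpha>
      else if j = n then \<phi> i \<beta>
      else if j \<le> n div 2 then
        t_formula (\<lambda>k s. deriv_within \<alpha> \<beta> s (b k) \<alpha>) (\<lambda>s. deriv_within \<alpha> \<beta> s (\<phi> i) \<alpha>) j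
      else
        t_formula (\<lambda>k s. deriv_within \<alpha> \<beta> s (b (n - k)) \<beta>)
          (\<lambda>s. deriv_within \<alpha> \<beta> s (\<phi> i) \<beta>) (n - j))"

end

theory Submission
  imports Defs
begin

text \<open>
  Since the \<open>b j\<close> span the same space, each \<open>\<phi> i\<close> has some expansion
  \<open>\<phi> i = (\<Sum>j\<le>n. t j * b j)\<close> on the interval, and the theorem follows by exchanging two sums
  as soon as these coefficients are known to be the \<open>t_coeff\<close>s.

  To find them, differentiate the expansion at \<open>\<alpha>\<close>. The \<open>s\<close>-th derivatives of \<open>b k\<close> vanish there
  for \<open>s < k\<close>, so the derivatives of \<open>\<phi> i\<close> are obtained from \<open>t\<close> by a triangular system with
  non-zero diagonal. Differentiating \<open>(\<Sum>k\<le>n. b k) = 1\<close> in the same way shows that \<open>t k\<close> may be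
  replaced by \<open>t k - t 0\<close> for \<open>s \<ge> 1\<close>, which removes the row \<open>k = 0\<close>. The inverse of a triangular
  matrix \<open>D (1 + N)\<close>, with \<open>D\<close> diagonal and \<open>N\<close> nilpotent, is given by the Neumann series of \<open>N\<close>,
  and the entries of the powers of \<open>N\<close> are the sums over increasing chains of indices in the
  formula. What is needed of that series is its functional equation, obtained by splitting off the
  first inner index of each chain (\<open>alternating_chain_sum_rec\<close>); it makes the sum in the formula
  telescope (\<open>t_formula_solves_triangular_system\<close>).

  At \<open>\<beta>\<close> the same argument applies to the reversed basis \<open>k \<mapsto> b (n - k)\<close>, because \<open>b (n - k)\<close>
  vanishes there to order \<open>k\<close>. Both end points determine every coefficient, so it does not matter
  which of the two formulas is chosen for a given column.
\<close>

section \<open>Alternating sums over chains\<close>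

lemma finite_chains: "finite (chains r j l)"
proof (rule finite_subset)
  show "chains r j l \<subseteq> {ks. set ks \<subseteq> {..j} \<and> length ks = l}"
    by (auto simp: chains_def sorted_wrt_append less_imp_le)
qed (simp add: finite_lists_length_eq)

lemma chains_eq_empty:
  assumes "r < j" "j \<le> r + l"
  shows "chains r j l = {}"
proof -
  have "length ks < j - r" if "sorted_wrt (<) (r # ks @ [j])" for ks
  proof -
    have "distinct ks"
      using that by (auto simp: sorted_wrt_append strict_sorted_iff)
    moreover have "set ks \<subseteq> {r<..<j}"
      using that by (auto simp: sorted_wrt_append)
    ultimately have "length ks \<le> card {r<..<j}"
      by (metis card_mono distinct_card finite_greaterThanLessThan)
    then show ?thesis
      using assms(1) by simp
  qed
  then show ?thesis
    using assms by (fastforce simp: chains_def)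
qed

lemma chain_sum_eq_0: "r < j \<Longrightarrow> j \<le> r + l \<Longrightarrow> chain_sum d r j l = 0"
  by (simp add: chain_sum_def chains_eq_empty)

lemma chain_sum_0: "r < j \<Longrightarrow> chain_sum d r j 0 = d r j"
proof -
  assume "r < j"
  then have "chains r j 0 = {[]}"
    by (auto simp: chains_def)
  then show ?thesis
    by (simp add: chain_sum_def)
qed

lemma chains_Suc: "chains r j (Suc l) = (\<Union>k\<in>{r<..<j}. (#) k ` chains k j l)"
proof (intro equalityI subsetI)
  fix ks assume "ks \<in> chains r j (Suc l)"
  then show "ks \<in> (\<Union>k\<in>{r<..<j}. (#) k ` chains k j l)"
    by (cases ks) (auto simp: chains_def sorted_wrt_append)
next
  fix ks assume "ks \<in> (\<Union>k\<in>{r<..<j}. (#) k ` chains k j l)"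
  then show "ks \<in> chains r j (Suc l)"
    by (fastforce simp: chains_def sorted_wrt_append)
qed

text \<open>Up to the diagonal factors, a chain sum is an entry of a power of the strictly triangular part
  of \<open>d\<close>. Multiplying by one more factor amounts to choosing the first inner index.\<close>

lemma chain_sum_Suc:
  "chain_sum d r j (Suc l) = (\<Sum>k\<in>{r<..<j}. d r k / d k k * chain_sum d k j l)"
proof -
  define T where "T r l ks =
    (let w = r # ks @ [j] in \<Prod>p\<le>l. d (w ! p) (w ! Suc p)) / (\<Prod>k\<leftarrow>ks. d k k)" for r l ks
  have "chain_sum d r j (Suc l) = (\<Sum>k\<in>{r<..<j}. sum (T r (Suc l)) ((#) k ` chains k j l))"
    unfolding chain_sum_def T_def chains_Suc
    by (rule sum.UNION_disjoint) (auto simp: finite_chains)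
  also have "\<dots> = (\<Sum>k\<in>{r<..<j}. \<Sum>ks\<in>chains k j l. T r (Suc l) (k # ks))"
    by (simp add: sum.reindex)
  also have "\<dots> = (\<Sum>k\<in>{r<..<j}. \<Sum>ks\<in>chains k j l. d r k / d k k * T k l ks)"
    by (simp add: T_def Let_def prod.atMost_Suc_shift del: prod.atMost_Suc)
  finally show ?thesis
    by (simp add: chain_sum_def T_def sum_distrib_left)
qed

text \<open>Up to sign and diagonal factors, this is an off-diagonal entry of the Neumann series for the
  triangular inverse. Chains from \<open>r\<close> to \<open>j\<close> have fewer than \<open>j - r\<close> inner indices; the cruder
  bound \<open>j\<close>, which does not depend on \<open>r\<close>, lets the series for different \<open>r\<close> be combined term
  by term.\<close>

definition alternating_chain_sum :: "(nat \<Rightarrow> nat \<Rightarrow> real) \<Rightarrow> nat \<Rightarrow> nat \<Rightarrow> real" where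
  "alternating_chain_sum d r j = (\<Sum>l<j. (-1) ^ l * chain_sum d r j l)"

lemma alternating_chain_sum_eq:
  assumes "r < j"
  shows "alternating_chain_sum d r j =
    d r j + (\<Sum>l = 1..j - r - 1. (- 1) ^ l * chain_sum d r j l)"
proof -
  have "alternating_chain_sum d r j = (\<Sum>l\<le>j - r - 1. (-1) ^ l * chain_sum d r j l)"
    unfolding alternating_chain_sum_def
    by (rule sum.mono_neutral_right) (use assms chain_sum_eq_0[of r j _ d] in \<open>force+\<close>)
  also have "\<dots> = d r j + (\<Sum>l = 1..j - r - 1. (- 1) ^ l * chain_sum d r j l)"
    using assms by (simp add: atMost_atLeast0 sum.atLeast_Suc_atMost chain_sum_0)
  finally show ?thesis .
qed

lemma alternating_chain_sum_rec:
  assumes "r < j"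
  shows "alternating_chain_sum d r j =
    d r j - (\<Sum>k\<in>{r<..<j}. d r k / d k k * alternating_chain_sum d k j)"
proof -
  obtain m where j: "j = Suc m"
    using assms by (cases j) auto
  have *: "(\<Sum>l<m. (-1) ^ l * chain_sum d k j l) = alternating_chain_sum d k j" if "k \<in> {r<..<j}" for k
    using that chain_sum_eq_0[of k j m d] by (simp add: alternating_chain_sum_def j)
  have "alternating_chain_sum d r j = d r j - (\<Sum>l<m. (-1) ^ l * chain_sum d r j (Suc l))"
    using assms chain_sum_0[OF assms]
    by (simp add: alternating_chain_sum_def j sum.lessThan_Suc_shift sum_negf del: sum.lessThan_Suc)
  also have "(\<Sum>l<m. (-1) ^ l * chain_sum d r j (Suc l)) =
      (\<Sum>l<m. \<Sum>k\<in>{r<..<j}. d r k / d k k * ((-1) ^ l * chain_sum d k j l))"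
    by (simp add: chain_sum_Suc sum_distrib_left mult_ac)
  also have "\<dots> = (\<Sum>k\<in>{r<..<j}. d r k / d k k * (\<Sum>l<m. (-1) ^ l * chain_sum d k j l))"
    by (subst sum.swap) (simp add: sum_distrib_left)
  finally show ?thesis
    by (simp add: *)
qed

text \<open>Substituting \<open>g r = (\<Sum>k = 1..r. (t k - t 0) * d k r)\<close> into the formula and collecting the terms
  of \<open>t k - t 0\<close>, the recursion of the alternating chain sums leaves exactly \<open>d k j\<close>
  as its coefficient, for each \<open>k < j\<close>. The remaining sum is \<open>g j\<close> without its diagonal
  term, so that only \<open>t j - t 0\<close> survives.\<close>

lemma t_formula_solves_triangular_system:
  assumes triangular: "\<And>k s. k \<le> n \<Longrightarrow> s < k \<Longrightarrow> d k s = 0"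
    and diagonal: "\<And>k. k \<le> n \<Longrightarrow> d k k \<noteq> 0"
    and unity: "\<And>s. s \<le> n \<Longrightarrow> (\<Sum>k\<le>n. d k s) = (if s = 0 then 1 else 0)"
    and system: "\<And>s. s \<le> n \<Longrightarrow> g s = (\<Sum>k\<le>n. t k * d k s)"
    and "1 \<le> j" "j \<le> n"
  shows "t_formula d g j = t j"
proof -
  define \<tau> where "\<tau> k = t k - t 0" for k
  let ?C = "alternating_chain_sum d"
  have cut: "(\<Sum>k\<le>n. c k * d k s) = c 0 * d 0 s + (\<Sum>k = 1..s. c k * d k s)" if "s \<le> n" for c s
  proof -
    have "(\<Sum>k\<le>n. c k * d k s) = (\<Sum>k\<le>s. c k * d k s)"
      by (rule sum.mono_neutral_right) (use that triangular in auto)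
    then show ?thesis
      by (simp add: atMost_atLeast0 sum.atLeast_Suc_atMost)
  qed
  have g0: "g 0 = t 0"
    using cut[of 0 t] cut[of 0 "\<lambda>_. 1"] unity[of 0] system[of 0] by simp
  have g: "g s = (\<Sum>k = 1..s. \<tau> k * d k s)" if "1 \<le> s" "s \<le> n" for s
  proof -
    have "g s = (\<Sum>k\<le>n. t k * d k s) - t 0 * (\<Sum>k\<le>n. d k s)"
      using system unity that by simp
    also have "\<dots> = (\<Sum>k\<le>n. \<tau> k * d k s)"
      by (simp add: \<tau>_def sum_distrib_left sum_subtractf left_diff_distrib)
    finally show ?thesis
      using cut[of s \<tau>] that by (simp add: \<tau>_def)
  qed
  have telescope: "(\<Sum>r = k..j - 1. d k r / d r r * ?C r j) = d k j" if "1 \<le> k" "k < j" for k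
  proof -
    have "{k..j - 1} = insert k {k<..<j}"
      using that by auto
    then have "(\<Sum>r = k..j - 1. d k r / d r r * ?C r j) =
        ?C k j + (\<Sum>r\<in>{k<..<j}. d k r / d r r * ?C r j)"
      using diagonal[of k] that \<open>j \<le> n\<close> by simp
    then show ?thesis
      using alternating_chain_sum_rec[of k j d] that by simp
  qed
  have "(\<Sum>r = 1..j - 1. g r / d r r * ?C r j) =
      (\<Sum>r = 1..j - 1. \<Sum>k = 1..r. \<tau> k * (d k r / d r r * ?C r j))"
    by (rule sum.cong)
      (use \<open>j \<le> n\<close> in \<open>auto simp: g sum_divide_distrib sum_distrib_right intro!: sum.cong\<close>)
  also have "\<dots> = (\<Sum>k = 1..j - 1. \<Sum>r = k..j - 1. \<tau> k * (d k r / d r r * ?C r j))"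
    by (simp add: sum.Sigma) (rule sum.reindex_bij_witness[of _ prod.swap prod.swap]; force)
  also have "\<dots> = (\<Sum>k = 1..j - 1. \<tau> k * d k j)"
    by (rule sum.cong[OF refl], subst sum_distrib_left[symmetric], subst telescope) auto
  also have "\<dots> = g j - \<tau> j * d j j"
    using g[of j] assms(5,6) by (cases j) auto
  finally have *: "(\<Sum>r = 1..j - 1. g r / d r r * ?C r j) = g j - \<tau> j * d j j" .
  have "t_formula d g j = g 0 - 1 / d j j * (\<Sum>r = 1..j - 1. g r / d r r * ?C r j) + g j / d j j"
    unfolding t_formula_def
    by (intro arg_cong2[of _ _ _ _ "(+)"] arg_cong2[of _ _ _ _ "(-)"]
          arg_cong2[of _ _ _ _ "(*)"] sum.cong refl)
       (auto simp: alternating_chain_sum_eq)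
  also have "\<dots> = t j"
    unfolding * g0 using diagonal[of j] \<open>j \<le> n\<close> by (simp add: \<tau>_def field_simps)
  finally show ?thesis .
qed

section \<open>Derivatives within an interval\<close>

lemma deriv_within_cong:
  assumes "\<And>x. x \<in> {\<alpha>..\<beta>} \<Longrightarrow> f x = g x" "x \<in> {\<alpha>..\<beta>}"
  shows "deriv_within \<alpha> \<beta> k f x = deriv_within \<alpha> \<beta> k g x"
  using assms(2)
proof (induction k arbitrary: x)
  case (Suc k)
  have "vector_derivative (deriv_within \<alpha> \<beta> k f) (at x within {\<alpha>..\<beta>}) =
      vector_derivative (deriv_within \<alpha> \<beta> k g) (at x within {\<alpha>..\<beta>})"
    by (rule vector_derivative_cong_eq) (use Suc in auto)
  then show ?case
    by simp
qed (use assms in auto)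

lemma deriv_within_const:
  assumes "\<alpha> < \<beta>" "x \<in> {\<alpha>..\<beta>}"
  shows "deriv_within \<alpha> \<beta> k (\<lambda>_. c) x = (if k = 0 then c else 0)"
  using assms(2)
proof (induction k arbitrary: x)
  case (Suc k)
  have "deriv_within \<alpha> \<beta> (Suc k) (\<lambda>_. c) x =
      vector_derivative (\<lambda>_. if k = 0 then c else 0) (at x within {\<alpha>..\<beta>})"
    unfolding deriv_within.simps
    by (rule vector_derivative_cong_eq) (use Suc in auto)
  also have "\<dots> = 0"
    using Suc.prems assms(1)
    by (intro vector_derivative_within_closed_interval) (auto intro: has_vector_derivative_const)
  finally show ?case
    by simp
qed simp

lemma deriv_within_sum:
  assumes "\<alpha> < \<beta>" and smooth: "\<And>i. i \<in> I \<Longrightarrow> Cn_on n \<alpha> \<beta> (f i)"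
    and "k \<le> n" "x \<in> {\<alpha>..\<beta>}"
  shows "deriv_within \<alpha> \<beta> k (\<lambda>x. \<Sum>i\<in>I. c i * f i x) x =
    (\<Sum>i\<in>I. c i * deriv_within \<alpha> \<beta> k (f i) x)"
  using assms(3,4)
proof (induction k arbitrary: x)
  case (Suc k)
  have "deriv_within \<alpha> \<beta> (Suc k) (\<lambda>x. \<Sum>i\<in>I. c i * f i x) x =
      vector_derivative (\<lambda>x. \<Sum>i\<in>I. c i * deriv_within \<alpha> \<beta> k (f i) x) (at x within {\<alpha>..\<beta>})"
    unfolding deriv_within.simps
    by (rule vector_derivative_cong_eq) (use Suc in auto)
  also have "\<dots> = (\<Sum>i\<in>I. c i * deriv_within \<alpha> \<beta> (Suc k) (f i) x)"
  proof (rule vector_derivative_within_closed_interval)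
    have "(deriv_within \<alpha> \<beta> k (f i) has_vector_derivative deriv_within \<alpha> \<beta> (Suc k) (f i) x)
        (at x within {\<alpha>..\<beta>})" if "i \<in> I" for i
      using smooth[OF that] Suc.prems
      by (auto simp: Cn_on_def differentiable_on_def vector_derivative_works[symmetric])
    then show "((\<lambda>x. \<Sum>i\<in>I. c i * deriv_within \<alpha> \<beta> k (f i) x) has_vector_derivative
        (\<Sum>i\<in>I. c i * deriv_within \<alpha> \<beta> (Suc k) (f i) x)) (at x within {\<alpha>..\<beta>})"
      by (auto intro!: has_vector_derivative_sum has_vector_derivative_mult_right)
  qed (use assms(1) Suc.prems in auto)
  finally show ?case .
qed simp

lemma differentiable_on_eq:
  assumes "f differentiable_on S" "\<And>x. x \<in> S \<Longrightarrow> f x = g x"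
  shows "g differentiable_on S"
  unfolding differentiable_on_def
proof
  fix x assume "x \<in> S"
  then show "g differentiable (at x within S)"
    using assms by (auto simp: differentiable_on_def intro: differentiable_transform_within[of f x S 1 g])
qed

lemma Cn_on_cong:
  assumes "\<And>x. x \<in> {\<alpha>..\<beta>} \<Longrightarrow> f x = g x" "Cn_on n \<alpha> \<beta> g"
  shows "Cn_on n \<alpha> \<beta> f"
proof -
  have eq: "deriv_within \<alpha> \<beta> k f x = deriv_within \<alpha> \<beta> k g x" if "x \<in> {\<alpha>..\<beta>}" for k x
    using deriv_within_cong[of \<alpha> \<beta> f g x k] assms(1) that by auto
  have "deriv_within \<alpha> \<beta> k f differentiable_on {\<alpha>..\<beta>}" if "k < n" for k
    by (rule differentiable_on_eq[of "deriv_within \<alpha> \<beta> k g"])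
      (use assms(2) that in \<open>auto simp: Cn_on_def eq\<close>)
  moreover have "continuous_on {\<alpha>..\<beta>} (deriv_within \<alpha> \<beta> n f)"
    using assms(2) unfolding Cn_on_def by (subst continuous_on_cong[OF refl eq]) auto
  ultimately show ?thesis
    by (simp add: Cn_on_def)
qed

lemma Cn_on_sum:
  assumes "\<alpha> < \<beta>" "finite I" and smooth: "\<And>i. i \<in> I \<Longrightarrow> Cn_on n \<alpha> \<beta> (f i)"
  shows "Cn_on n \<alpha> \<beta> (\<lambda>x. \<Sum>i\<in>I. c i * f i x)"
proof -
  let ?F = "\<lambda>x. \<Sum>i\<in>I. c i * f i x"
  have eq: "deriv_within \<alpha> \<beta> k ?F x = (\<Sum>i\<in>I. c i * deriv_within \<alpha> \<beta> k (f i) x)"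
    if "k \<le> n" "x \<in> {\<alpha>..\<beta>}" for k x
    using deriv_within_sum assms that by blast
  have "deriv_within \<alpha> \<beta> k ?F differentiable_on {\<alpha>..\<beta>}" if "k < n" for k
  proof (rule differentiable_on_eq)
    show "(\<lambda>x. \<Sum>i\<in>I. c i * deriv_within \<alpha> \<beta> k (f i) x) differentiable_on {\<alpha>..\<beta>}"
      using smooth that \<open>finite I\<close>
      by (auto simp: Cn_on_def differentiable_on_def intro!: differentiable_sum derivative_intros)
  qed (use eq that in auto)
  moreover have "continuous_on {\<alpha>..\<beta>} (deriv_within \<alpha> \<beta> n ?F)"
    using smooth by (subst continuous_on_cong[OF refl eq]) (auto simp: Cn_on_def intro!: continuous_intros)
  ultimately show ?thesis
    by (simp add: Cn_on_def)
qed

section \<open>The coefficients of the basis change\<close>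

lemma restrict_in_fun_span:
  assumes "i \<le> n"
  shows "restrict (\<phi> i) {\<alpha>..\<beta>} \<in> fun_span n \<alpha> \<beta> \<phi>"
proof -
  have "(\<Sum>k\<le>n. (if k = i then 1 else 0) * \<phi> k x) = \<phi> i x" for x
    using assms by (simp add: if_distrib[of "\<lambda>c. c * _"] cong: if_cong)
  then show ?thesis
    unfolding fun_span_def by (intro CollectI exI[of _ "\<lambda>k. if k = i then 1 else 0"]) auto
qed

lemma restrict_in_fun_spanE:
  assumes "restrict f {\<alpha>..\<beta>} \<in> fun_span n \<alpha> \<beta> \<phi>"
  obtains c where "\<And>x. x \<in> {\<alpha>..\<beta>} \<Longrightarrow> f x = (\<Sum>i\<le>n. c i * \<phi> i x)"
proof -
  obtain c where "restrict f {\<alpha>..\<beta>} = restrict (\<lambda>x. \<Sum>i\<le>n. c i * \<phi> i x) {\<alpha>..\<beta>}"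
    using assms by (auto simp: fun_span_def)
  then have "f x = (\<Sum>i\<le>n. c i * \<phi> i x)" if "x \<in> {\<alpha>..\<beta>}" for x
    using that by (auto simp: restrict_def dest!: fun_cong[of _ _ x])
  then show thesis ..
qed

lemma B_basis_expansion:
  assumes "\<alpha> < \<beta>" and smooth: "\<And>i. i \<le> n \<Longrightarrow> Cn_on n \<alpha> \<beta> (\<phi> i)"
    and \<phi>0: "\<And>u. u \<in> {\<alpha>..\<beta>} \<Longrightarrow> \<phi> 0 u = 1"
    and B: "normalized_B_basis n \<alpha> \<beta> \<phi> b" and "i \<le> n" "x \<in> {\<alpha>..\<beta>}"
  shows "\<phi> i x = (\<Sum>j\<le>n. t_coeff n \<alpha> \<beta> \<phi> b i j * b j x)"
proof (cases "i = 0")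
  case True
  then show ?thesis
    using B \<phi>0 \<open>x \<in> {\<alpha>..\<beta>}\<close> by (simp add: t_coeff_def normalized_B_basis_def)
next
  case False
  let ?D = "deriv_within \<alpha> \<beta>"
  have span: "fun_span n \<alpha> \<beta> b = fun_span n \<alpha> \<beta> \<phi>"
    using B by (simp add: normalized_B_basis_def fun_basis_def)
  have unity: "(\<Sum>k\<le>n. b k x) = 1" if "x \<in> {\<alpha>..\<beta>}" for x
    using B that by (simp add: normalized_B_basis_def)
  have at_\<alpha>: "?D s (b k) \<alpha> = 0" if "k \<le> n" "s < k" for k s
    using B that by (simp add: normalized_B_basis_def)
  have at_\<alpha>_pos: "0 < ?D k (b k) \<alpha>" if "k \<le> n" for k
    using B that by (simp add: normalized_B_basis_def)
  have at_\<beta>: "?D s (b (n - k)) \<beta> = 0" if "k \<le> n" "s < k" for k s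
  proof -
    have "n - k \<le> n" "s < n - (n - k)"
      using that by auto
    then show ?thesis
      using B unfolding normalized_B_basis_def by blast
  qed
  have at_\<beta>_nz: "?D k (b (n - k)) \<beta> \<noteq> 0" if "k \<le> n" for k
  proof -
    have "0 < (- 1) ^ (n - (n - k)) * ?D (n - (n - k)) (b (n - k)) \<beta>"
      using B unfolding normalized_B_basis_def by (metis diff_le_self)
    then show ?thesis
      using that by auto
  qed
  have b_smooth: "Cn_on n \<alpha> \<beta> (b k)" if k: "k \<le> n" for k
  proof -
    obtain c where "\<And>x. x \<in> {\<alpha>..\<beta>} \<Longrightarrow> b k x = (\<Sum>i\<le>n. c i * \<phi> i x)"
      using restrict_in_fun_span[OF k, of b \<alpha> \<beta>] span restrict_in_fun_spanE[of "b k"] by metis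
    then show ?thesis
      by (rule Cn_on_cong) (use Cn_on_sum[of \<alpha> \<beta> "{..n}" n \<phi>] assms smooth in auto)
  qed
  obtain t where t: "\<And>x. x \<in> {\<alpha>..\<beta>} \<Longrightarrow> \<phi> i x = (\<Sum>j\<le>n. t j * b j x)"
    using restrict_in_fun_span[OF \<open>i \<le> n\<close>, of \<phi> \<alpha> \<beta>] span restrict_in_fun_spanE[of "\<phi> i"] by metis
  have D\<phi>: "?D s (\<phi> i) x = (\<Sum>k\<le>n. t k * ?D s (b k) x)" if "s \<le> n" "x \<in> {\<alpha>..\<beta>}" for s x
    using deriv_within_cong[where f = "\<phi> i", OF t that(2), of s]
      deriv_within_sum[where I = "{..n}" and f = b and c = t, OF \<open>\<alpha> < \<beta>\<close> b_smooth that]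
    by simp
  have D1: "(\<Sum>k\<le>n. ?D s (b k) x) = (if s = 0 then 1 else 0)" if "s \<le> n" "x \<in> {\<alpha>..\<beta>}" for s x
    using deriv_within_sum[where I = "{..n}" and f = b and c = "\<lambda>_. 1", OF \<open>\<alpha> < \<beta>\<close> b_smooth that]
      deriv_within_cong[where f = "\<lambda>x. \<Sum>k\<le>n. b k x", OF unity that(2), of s] deriv_within_const[OF \<open>\<alpha> < \<beta>\<close> that(2), of s 1]
    by simp
  have formula_\<alpha>: "t_formula (\<lambda>k s. ?D s (b k) \<alpha>) (\<lambda>s. ?D s (\<phi> i) \<alpha>) j = t j"
    if "1 \<le> j" "j \<le> n" for j
    by (rule t_formula_solves_triangular_system[where n = n])
      (use that at_\<alpha> at_\<alpha>_pos D\<phi> D1 \<open>\<alpha> < \<beta>\<close> in \<open>auto simp: less_imp_neq[symmetric]\<close>)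
  have rev: "(\<Sum>k\<le>n. h (n - k)) = (\<Sum>k\<le>n. h k)" for h :: "nat \<Rightarrow> real"
    using sum.nat_diff_reindex[of h "Suc n"] by (simp add: lessThan_Suc_atMost)
  have formula_\<beta>: "t_formula (\<lambda>k s. ?D s (b (n - k)) \<beta>) (\<lambda>s. ?D s (\<phi> i) \<beta>) j = t (n - j)"
    if "1 \<le> j" "j \<le> n" for j
  proof (rule t_formula_solves_triangular_system[where n = n])
    fix s assume "s \<le> n"
    then show "(\<Sum>k\<le>n. ?D s (b (n - k)) \<beta>) = (if s = 0 then 1 else 0)"
      using D1[of s \<beta>] rev[of "\<lambda>k. ?D s (b k) \<beta>"] \<open>\<alpha> < \<beta>\<close> by simp
    show "?D s (\<phi> i) \<beta> = (\<Sum>k\<le>n. t (n - k) * ?D s (b (n - k)) \<beta>)"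
      using D\<phi>[of s \<beta>] rev[of "\<lambda>k. t k * ?D s (b k) \<beta>"] \<open>\<alpha> < \<beta>\<close> \<open>s \<le> n\<close> by simp
  qed (use that at_\<beta> at_\<beta>_nz in auto)
  have "t_coeff n \<alpha> \<beta> \<phi> b i j = t j" if "j \<le> n" for j
  proof -
    \<comment> \<open>At an end point all but one basis function vanish, and that one has the value 1.\<close>
    have "\<phi> i \<alpha> = t 0"
    proof -
      have "(\<Sum>k\<le>n. t k * b k \<alpha>) = (\<Sum>k\<in>{0}. t k * b k \<alpha>)"
        using at_\<alpha>[of _ 0] by (intro sum.mono_neutral_right) auto
      then show ?thesis
        using t[of \<alpha>] B \<open>\<alpha> < \<beta>\<close> by (simp add: normalized_B_basis_def)
    qed
    moreover have "\<phi> i \<beta> = t n"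
    proof -
      have "(\<Sum>k\<le>n. t k * b k \<beta>) = (\<Sum>k\<in>{n}. t k * b k \<beta>)"
        using at_\<beta>[of "n - _" 0] by (intro sum.mono_neutral_right) auto
      then show ?thesis
        using t[of \<beta>] B \<open>\<alpha> < \<beta>\<close> by (simp add: normalized_B_basis_def)
    qed
    ultimately show ?thesis
      using False that formula_\<alpha>[of j] formula_\<beta>[of "n - j"] by (auto simp: t_coeff_def)
  qed
  then show ?thesis
    using t[OF \<open>x \<in> {\<alpha>..\<beta>}\<close>] by simp
qed

theorem theorem2p2:
  fixes n :: nat and \<alpha> \<beta> :: real
    and \<phi> b :: "nat \<Rightarrow> real \<Rightarrow> real"
    and lam :: "nat \<Rightarrow> real ^ 'd"
  assumes "1 \<le> n" and "\<alpha> < \<beta>"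
    and "EC_system n \<alpha> \<beta> \<phi>"
    and "positive_hermite_dets n \<alpha> \<beta> \<phi>"
    and "\<forall>u\<in>{\<alpha>..\<beta>}. \<phi> 0 u = 1"
    and "normalized_B_basis n \<alpha> \<beta> \<phi> b"
    and "2 \<le> CARD('d)"
  shows "\<forall>u\<in>{\<alpha>..\<beta>}.
    (\<Sum>i\<le>n. \<phi> i u *\<^sub>R lam i) =
    (\<Sum>j\<le>n. b j u *\<^sub>R (\<chi> l. \<Sum>i\<le>n. vec_nth (lam i) l * t_coeff n \<alpha> \<beta> \<phi> b i j))"
proof
  fix u assume u: "u \<in> {\<alpha>..\<beta>}"
  let ?t = "t_coeff n \<alpha> \<beta> \<phi> b"
  have \<phi>: "\<phi> i u = (\<Sum>j\<le>n. ?t i j * b j u)" if "i \<le> n" for i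
    using B_basis_expansion[of \<alpha> \<beta> n \<phi> b i u] assms u that by (auto simp: EC_system_def)
  have "(\<Sum>i\<le>n. \<phi> i u * vec_nth (lam i) l) =
      (\<Sum>j\<le>n. b j u * (\<Sum>i\<le>n. vec_nth (lam i) l * ?t i j))" for l
  proof -
    have "(\<Sum>i\<le>n. \<phi> i u * vec_nth (lam i) l) =
        (\<Sum>i\<le>n. \<Sum>j\<le>n. b j u * (vec_nth (lam i) l * ?t i j))"
      by (simp add: \<phi> sum_distrib_left mult_ac)
    then show ?thesis
      by (subst (asm) sum.swap) (simp add: sum_distrib_left)
  qed
  then show "(\<Sum>i\<le>n. \<phi> i u *\<^sub>R lam i) =
      (\<Sum>j\<le>n. b j u *\<^sub>R (\<chi> l. \<Sum>i\<le>n. vec_nth (lam i) l * ?t i j))"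
    by (simp add: vec_eq_iff)
qed

end
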